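(* Let $m,n\in\mathbb{N}=\{1,2,\dotsc\}$ and let $\lambda=(\lambda_{ij})_{1\le i\le m,\,1\le j\le n}$ be a matrix such that $\lambda_{ij}>0$ for $1\le i\le m$ and $1\le j\le n$. Let $\alpha=(\alpha_1,\alpha_2,\dotsc,\alpha_m)$ and $\beta=(\beta_1,\beta_2,\dotsc,\beta_n)$ be such that $\alpha_i=\sum_{j=1}^{n}\lambda_{ij}$ and $\beta_j=\sum_{i=1}^{m}\lambda_{ij}$ for $1\le i\le m$ and $1\le j\le n$. Let $\rho\in\mathbb{R}$ and $$ f_{m,n;\lambda,\alpha,\beta;\rho}(t)=\frac{\prod_{i=1}^{m}\Gamma(1+\alpha_it)\prod_{j=1}^{n}\Gamma(1+\beta_jt)}{\bigl[\prod_{i=1}^{m}\prod_{j=1}^{n}\Gamma(1+\lambda_{ij}t)\bigr]^\rho}. $$ Then the following conclusions are valid. (1) When $\rho\le2$, the second derivative $[\ln f_{m,n;\lambda,\alpha,\beta;\rho}(t)]''$ is a completely monotonic function of $t\in(0,\infty)$ and maps from $(0,\infty)$ onto the open interval $$ \Biggl(0,\ \frac{\pi^2}{6}\Biggl(\sum_{i=1}^{m}\alpha_i^2+\sum_{j=1}^{n}\beta_j^2-\rho\sum_{i=1}^{m}\sum_{j=1}^{n}\lambda_{ij}^2\Biggr)\Biggr). $$ (2) When $\rho=2$, the logarithmic derivative $[\ln f_{m,n;\lambda,\alpha,\beta;2}(t)]'=\frac{f_{m,n;\lambda,\alpha,\beta;2}'(t)}{f_{m,n;\lambda,\alpha,\beta;2}(t)}$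 is a Bernstein function of $t\in(0,\infty)$ and maps from $(0,\infty)$ onto the open interval $$ \left(0,\ \ln\frac{\prod_{i=1}^{m}\alpha_i^{\alpha_i}\prod_{j=1}^{n}\beta_j^{\beta_j}}{\bigl(\prod_{i=1}^{m}\prod_{j=1}^{n}\lambda_{ij}^{\lambda_{ij}}\bigr)^2}\right). $$ (3) When $\rho<2$, the logarithmic derivative $[\ln f_{m,n;\lambda,\alpha,\beta;\rho}(t)]'$ is increasing, concave, and maps from $(0,\infty)$ onto the open interval $$ \Biggl(-\gamma(2-\rho)\sum_{i=1}^{m}\sum_{j=1}^{n}\lambda_{ij},\ \infty\Biggr), $$ where $\gamma=0.57721566\dotsc$ is the Euler--Mascheroni constant. (4) When $\rho=2$, the function $f_{m,n;\lambda,\alpha,\beta;2}(t)$ is increasing, logarithmically convex, and maps from $(0,\infty)$ onto the open interval $(1,\infty)$. (5) When $\rho<2$, the function $f_{m,n;\lambda,\alpha,\beta;\rho}(t)$ has a unique minimum on $(0,\infty)$, is logarithmically convex, and satisfies $$ \lim_{t\to0^+}f_{m,n;\lambda,\alpha,\beta;\rho}(t)=1\quad\text{and}\quad\lim_{t\to\infty}f_{m,n;\lambda,\alpha,\beta;\rho}(t)=\infty. $$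
   Context: $\Gamma$ denotes the classical Euler gamma function. A real-valued function $f$ defined on a finite or infinite interval $I\subseteq\mathbb{R}$ is called completely monotonic on $I$ if and only if $(-1)^kf^{(k)}(x)\ge0$ for all $k\in\{0\}\cup\mathbb{N}$ and $x\in I$. A nonnegative function $f$ defined on a finite or infinite interval $I$ is called a Bernstein function if its derivative $f'$ is completely monotonic on $I$. A positive function is logarithmically convex if its logarithm is convex.
   Formalization: For m = n = 1 and ρ = 2 the function f is identically 1, so the range claims in (1), (2) and (4) and strict increase in (4) are false; these claims are asserted only outside that case, where f is still shown weakly increasing. *)

theory Defs
  imports "HOL-Analysis.Analysis"
begin

text \<open>
  The witness \<open>D\<close> is the sequence of successive derivatives of \<open>f\<close>. Derivatives are taken within
  \<open>I\<close>, so they are one-sided at an endpoint belonging to \<open>I\<close>; on a nondegenerate interval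
  every \<open>D k\<close> is determined on \<open>I\<close> by \<open>f\<close>. In particular \<open>f\<close> is smooth on \<open>I\<close>.
\<close>

definition completely_monotonic_on :: "real set \<Rightarrow> (real \<Rightarrow> real) \<Rightarrow> bool" where
  "completely_monotonic_on I f \<longleftrightarrow>
     is_interval I \<and>
     (\<exists>D :: nat \<Rightarrow> real \<Rightarrow> real.
        (\<forall>x\<in>I. D 0 x = f x) \<and>
        (\<forall>k. \<forall>x\<in>I. (D k has_real_derivative D (Suc k) x) (at x within I)) \<and>
        (\<forall>k. \<forall>x\<in>I. (-1) ^ k * D k x \<ge> 0))"

definition bernstein_on :: "real set \<Rightarrow> (real \<Rightarrow> real) \<Rightarrow> bool" where
  "bernstein_on I f \<longleftrightarrow>
     (\<forall>x\<in>I. f x \<ge> 0) \<and>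
     (\<exists>f'. (\<forall>x\<in>I. (f has_real_derivative f' x) (at x within I)) \<and>
           completely_monotonic_on I f')"

definition log_convex_on :: "real set \<Rightarrow> (real \<Rightarrow> real) \<Rightarrow> bool" where
  "log_convex_on I f \<longleftrightarrow> (\<forall>x\<in>I. f x > 0) \<and> convex_on I (\<lambda>x. ln (f x))"

text \<open>
  Matrices and vectors are functions on \<open>nat\<close> of which only the entries with indices in
  \<open>{1..m}\<close> and \<open>{1..n}\<close> are used. The base of \<open>powr\<close> is positive for positive
  entries and \<open>t > 0\<close>.
\<close>

definition gamma_ratio ::
  "nat \<Rightarrow> nat \<Rightarrow> (nat \<Rightarrow> nat \<Rightarrow> real) \<Rightarrow> (nat \<Rightarrow> real) \<Rightarrow> (nat \<Rightarrow> real) \<Rightarrow> real \<Rightarrow> real \<Rightarrow> real" where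
  "gamma_ratio m n lam \<alpha> \<beta> \<rho> t =
     ((\<Prod>i=1..m. Gamma (1 + \<alpha> i * t)) * (\<Prod>j=1..n. Gamma (1 + \<beta> j * t))) /
     (\<Prod>i=1..m. \<Prod>j=1..n. Gamma (1 + lam i j * t)) powr \<rho>"

end

theory Submission imports Defs begin

text \<open>
  Write \<open>E \<phi> = (\<Sum>i. \<phi> (\<alpha> i)) + (\<Sum>j. \<phi> (\<beta> j)) - \<rho> * (\<Sum>i. \<Sum>j. \<phi> (lam i j))\<close>. For \<open>t \<ge> 0\<close> the
  logarithm of the gamma ratio is \<open>E\<close> applied to \<open>a \<mapsto> ln \<Gamma>(1 + a t)\<close>, and since \<open>E\<close> is linear its
  derivative of order \<open>k + 1\<close> is \<open>E\<close> applied to \<open>a \<mapsto> a\<^sup>k\<^sup>+\<^sup>1 \<psi>\<^sup>(\<^sup>k\<^sup>)(1 + a t)\<close>. So every claim reduces to the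
  sign of \<open>E \<phi>\<close> for these \<open>\<phi>\<close>, together with the behaviour at \<open>0\<close> and at infinity.

  Sign. If \<open>\<phi>\<close> is positive and \<open>\<phi>(a) / a\<close> increases, then \<open>\<phi>\<close> is superadditive, so both the row
  sums and the column sums contribute at least \<open>\<Sum>i. \<Sum>j. \<phi> (lam i j)\<close> and \<open>E \<phi> \<ge> 0\<close> for \<open>\<rho> \<le> 2\<close>, strictly
  except for a single entry with \<open>\<rho> = 2\<close> (\<open>marginal_excess_nonneg\<close>). For the \<open>k\<close>-th polygamma
  function, \<open>k \<ge> 1\<close>, the quotient is, up to sign, \<open>(a t)\<^sup>k \<psi>\<^sup>(\<^sup>k\<^sup>)(1 + a t) / t\<^sup>k\<close>, and it increases in
  \<open>a\<close> because \<open>x\<^sup>k |\<psi>\<^sup>(\<^sup>k\<^sup>)(1 + x)|\<close> increases in \<open>x\<close>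
  (\<open>power_times_signed_polygamma_strict_mono\<close>). The last fact says that the right Riemann sums
  \<open>h * (\<Sum>n\<ge>1. q (n h))\<close> of the convex decreasing function \<open>q(y) = 1 / (y + 1)\<^sup>k\<^sup>+\<^sup>1\<close> decrease in the step
  \<open>h = 1 / x\<close>. Its proof compares the terms of the differentiated series with a telescoping series
  by means of the tangent inequality.

  Range. As all derivatives exist at \<open>0\<close> as well, the values there are end points of the
  ranges: \<open>\<psi>(1) = -\<gamma>\<close> and \<open>\<psi>'(1) = \<pi>\<^sup>2 / 6\<close>. At infinity \<open>0 < \<psi>'(1 + x) \<le> 1 / x\<close> gives the limit \<open>0\<close> of
  the second derivative, and \<open>ln x \<le> \<psi>(1 + x) \<le> ln x + 1 / x\<close> shows that the first derivative is
  \<open>(2 - \<rho>) (\<Sum>i. \<Sum>j. lam i j) ln t + E (\<lambda>a. a ln a) + o(1)\<close>.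
\<close>

section \<open>Growth of the polygamma functions\<close>

lemma pos_not_nonpos_Int: "(x :: real) > 0 \<Longrightarrow> x \<notin> \<int>\<^sub>\<le>\<^sub>0"
  by (auto elim!: nonpos_Ints_cases)

text \<open>
  Strict convexity of \<open>y\<^sup>-\<^sup>p\<close> compares the value at \<open>y + 1\<close> with the tangent at \<open>y\<close>. After division by
  \<open>y\<^sup>-\<^sup>p\<close> it follows from Bernoulli's inequality for \<open>(1 - 1 / (y + 1))\<^sup>p\<close>.
\<close>

lemma inverse_power_above_tangent:
  fixes y :: real
  assumes "y > 0" and "p > 0"
  shows "inverse (y ^ p) - real p * inverse (y ^ Suc p) < inverse ((y + 1) ^ p)"
proof -
  have "1 - real p / y < 1 - real p / (y + 1)"
    using assms by (simp add: frac_less2)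
  also have "\<dots> \<le> (y / (y + 1)) ^ p"
  proof -
    have "y / (y + 1) = 1 + - (1 / (y + 1))" using assms by (simp add: field_simps)
    then show ?thesis
      using Bernoulli_inequality[of "- (1 / (y + 1))" p] assms by simp
  qed
  finally have "inverse (y ^ p) * (1 - real p / y) < inverse (y ^ p) * (y / (y + 1)) ^ p"
    using assms by (intro mult_strict_left_mono) auto
  also have "inverse (y ^ p) * (y / (y + 1)) ^ p = inverse ((y + 1) ^ p)"
    using assms by (simp add: power_divide field_simps)
  finally show ?thesis
    using assms by (simp add: field_simps)
qed

text \<open>
  With \<open>q(N) = (N + x)\<^sup>-\<^sup>p\<close> for \<open>N = n + 1\<close>, the difference of the two sides is the sum over \<open>N \<ge> 1\<close> of
  \<open>- q(N) - N q'(N)\<close>. By convexity \<open>q'(N) < q(N + 1) - q(N)\<close>, so each term exceeds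
  \<open>(N - 1) q(N) - N q(N + 1)\<close>, and these lower bounds telescope to \<open>0\<close>.
\<close>

lemma inverse_power_series_ratio:
  fixes x :: real
  assumes x: "x > 0" and p: "p \<ge> 2"
  shows "x * (real p * (\<Sum>n. inverse ((1 + x + real n) ^ Suc p)))
         < (real p - 1) * (\<Sum>n. inverse ((1 + x + real n) ^ p))"
proof -
  define a where "a = (\<lambda>q n. inverse ((1 + x + real n) ^ q))"
  define G where "G = (\<lambda>n. real n * a p n)"
  \<comment> \<open>\<open>d n\<close> is the gap between a term and its telescoping lower bound.\<close>
  define d where "d = (\<lambda>n. ((real p - 1) * a p n - x * (real p * a (Suc p) n)) - (G n - G (Suc n)))"
  have a_summable: "summable (a q)" if "q \<ge> 2" for q
    using Polygamma_converges'[of "1 + x" q] that x by (simp add: a_def)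
  have ser: "(\<lambda>n. (real p - 1) * a p n - x * (real p * a (Suc p) n)) sums
      ((real p - 1) * suminf (a p) - x * (real p * suminf (a (Suc p))))"
    using p by (intro sums_diff sums_mult summable_sums a_summable) auto
  have "G \<longlonglongrightarrow> 0"
  proof (rule tendsto_sandwich[OF _ _ tendsto_const LIMSEQ_inverse_real_of_nat])
    show "\<forall>\<^sub>F n in sequentially. 0 \<le> G n"
      using x by (auto simp: G_def a_def)
    have "G n \<le> inverse (real (Suc n))" for n
    proof -
      have "real n * real (Suc n) \<le> (1 + x + real n) ^ 2"
        using x by (simp add: power2_eq_square mult_mono)
      also have "\<dots> \<le> (1 + x + real n) ^ p"
        using x p by (intro power_increasing) auto
      finally show ?thesis using x by (simp add: G_def a_def field_simps)
    qed
    then show "\<forall>\<^sub>F n in sequentially. G n \<le> inverse (real (Suc n))" by simp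
  qed
  then have tel: "(\<lambda>n. G n - G (Suc n)) sums 0"
    using telescope_sums'[of G 0] by (simp add: G_def)
  have d_sums: "d sums ((real p - 1) * suminf (a p) - x * (real p * suminf (a (Suc p))))"
    using sums_diff[OF ser tel] by (simp add: d_def)
  have "d n > 0" for n
  proof -
    define y where "y = 1 + x + real n"
    have y: "y > 0" using x by (simp add: y_def)
    have "x * a (Suc p) n = a p n - real (Suc n) * a (Suc p) n"
    proof -
      have "x * a (Suc p) n = (y - real (Suc n)) * inverse (y ^ Suc p)"
        by (simp add: a_def y_def)
      also have "\<dots> = y * inverse (y ^ Suc p) - real (Suc n) * inverse (y ^ Suc p)"
        by (simp add: algebra_simps)
      also have "y * inverse (y ^ Suc p) = inverse (y ^ p)"
        using y by simp
      finally show ?thesis by (simp add: a_def y_def)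
    qed
    then have "x * (real p * a (Suc p) n) = real p * (a p n - real (Suc n) * a (Suc p) n)"
      by simp
    moreover have "a p n = inverse (y ^ p)" "a (Suc p) n = inverse (y ^ Suc p)"
        "a p (Suc n) = inverse ((y + 1) ^ p)"
      by (simp_all add: a_def y_def algebra_simps)
    ultimately have "d n = real (Suc n) * (inverse ((y + 1) ^ p) - (inverse (y ^ p) - real p * inverse (y ^ Suc p)))"
      unfolding d_def G_def by (simp only:) (simp add: ring_distribs)
    then show ?thesis
      using inverse_power_above_tangent[OF y, of p] p by simp
  qed
  then have "0 < suminf d" using d_sums by (intro suminf_pos) (auto simp: sums_iff)
  then show ?thesis using d_sums by (simp add: sums_iff a_def)
qed

lemma signed_polygamma_series:
  fixes x :: real
  assumes "k \<ge> 1"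
  shows "(-1) ^ Suc k * Polygamma k x = fact k * (\<Sum>n. inverse ((x + real n) ^ Suc k))"
  using assms by (simp add: Polygamma_def flip: power_mult_distrib mult.assoc)

lemma signed_polygamma_pos:
  fixes x :: real
  assumes "k \<ge> 1" "x > 0"
  shows "(-1) ^ Suc k * Polygamma k x > 0"
proof -
  show ?thesis
    using Polygamma_real_odd_pos[of x k] Polygamma_real_even_neg[of x k] assms
    by (cases "even k") (auto simp: pos_not_nonpos_Int)
qed

lemma polygamma_ratio_bound:
  fixes x :: real
  assumes "x > 0" "k \<ge> 1"
  shows "x * ((-1) ^ Suc (Suc k) * Polygamma (Suc k) (1 + x))
         < real k * ((-1) ^ Suc k * Polygamma k (1 + x))"
proof -
  have "x * ((-1) ^ Suc (Suc k) * Polygamma (Suc k) (1 + x)) =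
      fact k * (x * (real (Suc k) * (\<Sum>n. inverse ((1 + x + real n) ^ Suc (Suc k)))))"
    unfolding signed_polygamma_series[of "Suc k", simplified] using signed_polygamma_series[of "Suc k" "1 + x"] by simp
  also have "\<dots> < fact k * ((real (Suc k) - 1) * (\<Sum>n. inverse ((1 + x + real n) ^ Suc k)))"
    using inverse_power_series_ratio[of x "Suc k"] assms by (intro mult_strict_left_mono) auto
  also have "\<dots> = real k * ((-1) ^ Suc k * Polygamma k (1 + x))"
    using signed_polygamma_series[of k "1 + x"] assms by simp
  finally show ?thesis .
qed

text \<open>
  The derivative is \<open>x\<^sup>k\<^sup>-\<^sup>1\<close> times the difference of the two sides of \<open>polygamma_ratio_bound\<close>.
\<close>

lemma power_times_signed_polygamma_strict_mono:
  fixes x y :: real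
  assumes "k \<ge> 1" "0 < x" "x < y"
  shows "x ^ k * ((-1) ^ Suc k * Polygamma k (1 + x)) < y ^ k * ((-1) ^ Suc k * Polygamma k (1 + y))"
proof (rule DERIV_pos_imp_increasing[OF \<open>x < y\<close>])
  fix z assume "x \<le> z" "z \<le> y"
  then have z: "z > 0" using assms by simp
  have deriv: "((\<lambda>z. (-1) ^ Suc k * Polygamma k (1 + z)) has_real_derivative
      (-1) ^ Suc k * Polygamma (Suc k) (1 + z)) (at z)"
    using z by (auto intro!: derivative_eq_intros simp: pos_not_nonpos_Int)
  have "z ^ k = z ^ (k - 1) * z"
    using assms(1) by (cases k) auto
  then have "((\<lambda>z. z ^ k * ((-1) ^ Suc k * Polygamma k (1 + z))) has_real_derivative
      z ^ (k - 1) * (real k * ((-1) ^ Suc k * Polygamma k (1 + z))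
        - z * ((-1) ^ Suc (Suc k) * Polygamma (Suc k) (1 + z)))) (at z)"
    by (intro DERIV_cong[OF DERIV_mult[OF DERIV_pow[of k z UNIV] deriv]]) (simp add: algebra_simps)
  moreover have "z ^ (k - 1) * (real k * ((-1) ^ Suc k * Polygamma k (1 + z))
        - z * ((-1) ^ Suc (Suc k) * Polygamma (Suc k) (1 + z))) > 0"
    using polygamma_ratio_bound[OF z assms(1)] z by (intro mult_pos_pos) auto
  ultimately show "\<exists>D. ((\<lambda>z. z ^ k * ((-1) ^ Suc k * Polygamma k (1 + z))) has_real_derivative D) (at z) \<and> 0 < D"
    by blast
qed

section \<open>Bounds for the digamma and trigamma functions\<close>

text \<open>
  By the mean value theorem \<open>ln x = ln \<Gamma>(x + 1) - ln \<Gamma>(x)\<close> is a value of \<open>\<psi>\<close> between \<open>\<psi>(x)\<close> and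
  \<open>\<psi>(x + 1) = \<psi>(x) + 1 / x\<close>.
\<close>

lemma Digamma_ln_bounds:
  fixes x :: real
  assumes "x > 0"
  shows "ln x \<le> Digamma (1 + x)" "Digamma (1 + x) \<le> ln x + 1 / x"
proof -
  have "(ln_Gamma has_real_derivative Digamma u) (at u)" if "x \<le> u" for u
    using that assms by (intro has_field_derivative_ln_Gamma_real) auto
  then obtain z where z: "x < z" "z < x + 1" "ln_Gamma (x + 1) - ln_Gamma x = Digamma z"
    using MVT2[of x "x + 1" ln_Gamma Digamma] by auto
  have "ln_Gamma (x + 1) - ln_Gamma x = ln x"
    using assms Gamma_plus1[of x] by (simp add: ln_Gamma_real_pos ln_mult_pos pos_not_nonpos_Int)
  then have "Digamma z = ln x" using z by simp
  moreover have "Digamma z \<le> Digamma (1 + x)" "Digamma x \<le> Digamma z"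
    using z assms by (auto intro!: Digamma_real_mono)
  moreover have "Digamma (1 + x) = Digamma x + 1 / x"
    using Digamma_plus1[of x] assms by (simp add: add.commute)
  ultimately show "ln x \<le> Digamma (1 + x)" "Digamma (1 + x) \<le> ln x + 1 / x" by auto
qed

text \<open>
  The same argument one derivative higher, using \<open>\<psi>(x + 1) - \<psi>(x) = 1 / x\<close> and that \<open>\<psi>'\<close> decreases.
\<close>

lemma Polygamma_1_le_inverse:
  fixes x :: real
  assumes "x > 0"
  shows "Polygamma 1 (1 + x) \<le> 1 / x"
proof -
  have "(Digamma has_real_derivative Polygamma 1 u) (at u)" if "x \<le> u" for u
    using that assms has_field_derivative_Polygamma[of u 0 UNIV] by (simp add: pos_not_nonpos_Int)
  then obtain z where z: "x < z" "z < x + 1" "Digamma (x + 1) - Digamma x = Polygamma 1 z"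
    using MVT2[of x "x + 1" Digamma "Polygamma 1"] by auto
  have "Polygamma 1 (1 + x) < Polygamma 1 z"
    using z assms by (intro Polygamma_real_strict_antimono) auto
  also have "\<dots> = 1 / x" using z Digamma_plus1[of x] assms by simp
  finally show ?thesis by simp
qed

lemma Polygamma_1_1: "Polygamma 1 (1 :: real) = pi\<^sup>2 / 6"
proof -
  have "Polygamma 1 (1 :: real) = (\<Sum>n. 1 / (real n + 1)\<^sup>2)"
    using signed_polygamma_series[of 1 "1::real"]
    by (simp add: power2_eq_square add.commute inverse_eq_divide)
  also have "\<dots> = pi\<^sup>2 / 6"
    using sums_unique[OF inverse_squares_sums] by (simp add: add.commute)
  finally show ?thesis .
qed


section \<open>Ranges of increasing functions on a half-line\<close>

text \<open>
  The derivative is assumed positive only for \<open>t > 0\<close>: the strict sign result for polygamma sums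
  is available for positive arguments only, whereas the value at \<open>0\<close> serves as left end of the range.
\<close>

lemma DERIV_pos_strict_mono_image:
  fixes g g' :: "real \<Rightarrow> real"
  assumes deriv: "\<And>t. t \<ge> 0 \<Longrightarrow> (g has_real_derivative g' t) (at t)"
    and pos: "\<And>t. t > 0 \<Longrightarrow> g' t > 0"
  shows "strict_mono_on {0..} g"
    and "g ` {0<..} = {y. g 0 < y \<and> (\<exists>t>0. y < g t)}"
proof -
  have cont: "continuous_on {s..t} g" if "s \<ge> 0" for s t
    using that deriv by (intro continuous_at_imp_continuous_on ballI DERIV_isCont[OF deriv]) auto
  have mono: "g s < g t" if "0 \<le> s" "s < t" for s t
  proof (rule DERIV_pos_imp_increasing_open[OF \<open>s < t\<close> _ cont[OF \<open>0 \<le> s\<close>]])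
    fix x assume "s < x" "x < t"
    then show "\<exists>y. (g has_real_derivative y) (at x) \<and> 0 < y"
      using deriv[of x] pos[of x] that by auto
  qed
  then show "strict_mono_on {0..} g"
    by (auto simp: strict_mono_on_def)
  show "g ` {0<..} = {y. g 0 < y \<and> (\<exists>t>0. y < g t)}"
  proof (intro equalityI subsetI)
    fix y assume "y \<in> g ` {0<..}"
    then obtain t where t: "t > 0" "y = g t" by auto
    then have "g 0 < y" "y < g (t + 1)" "t + 1 > 0" using mono[of 0 t] mono[of t "t + 1"] by auto
    then show "y \<in> {y. g 0 < y \<and> (\<exists>t>0. y < g t)}" by blast
  next
    fix y assume "y \<in> {y. g 0 < y \<and> (\<exists>t>0. y < g t)}"
    then obtain t where y: "g 0 < y" "t > 0" "y < g t" by auto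
    then obtain s where s: "0 \<le> s" "s \<le> t" "g s = y"
      using IVT'[of g 0 y t] cont[of 0 t] by auto
    then have "s > 0" using y by (cases "s = 0") auto
    then show "y \<in> g ` {0<..}" using s by auto
  qed
qed

lemma DERIV_pos_image_tendsto:
  fixes g g' :: "real \<Rightarrow> real"
  assumes deriv: "\<And>t. t \<ge> 0 \<Longrightarrow> (g has_real_derivative g' t) (at t)"
    and pos: "\<And>t. t > 0 \<Longrightarrow> g' t > 0"
    and lim: "(g \<longlongrightarrow> b) at_top"
  shows "g ` {0<..} = {g 0<..<b}"
proof -
  have mono: "strict_mono_on {0..} g"
    using deriv pos by (rule DERIV_pos_strict_mono_image)
  have "g t < b" if "t > 0" for t
  proof -
    have "\<forall>\<^sub>F s in at_top. g (t + 1) \<le> g s"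
      using eventually_ge_at_top[of "t + 1"]
    proof eventually_elim
      case (elim s)
      then show ?case using strict_mono_on_leD[OF mono, of "t + 1" s] that by simp
    qed
    then have "g (t + 1) \<le> b"
      by (rule tendsto_lowerbound[OF lim]) simp
    moreover have "g t < g (t + 1)" using strict_mono_onD[OF mono, of t "t + 1"] that by simp
    ultimately show ?thesis by simp
  qed
  moreover have "\<exists>t>0. y < g t" if "y < b" for y
  proof -
    have "\<forall>\<^sub>F t in at_top. y < g t \<and> t > 0"
      using order_tendstoD(1)[OF lim that] eventually_gt_at_top by (rule eventually_conj)
    then show ?thesis using eventually_happens by fastforce
  qed
  ultimately have "(\<exists>t>0. y < g t) \<longleftrightarrow> y < b" for y
    by (meson less_trans)
  moreover have "g ` {0<..} = {y. g 0 < y \<and> (\<exists>t>0. y < g t)}"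
    using deriv pos by (rule DERIV_pos_strict_mono_image)
  ultimately show ?thesis by auto
qed

lemma DERIV_pos_image_at_top:
  fixes g g' :: "real \<Rightarrow> real"
  assumes deriv: "\<And>t. t \<ge> 0 \<Longrightarrow> (g has_real_derivative g' t) (at t)"
    and pos: "\<And>t. t > 0 \<Longrightarrow> g' t > 0"
    and lim: "filterlim g at_top at_top"
  shows "g ` {0<..} = {g 0<..}"
proof -
  have "\<exists>t>0. y < g t" for y
  proof -
    have "\<forall>\<^sub>F t in at_top. y < g t"
      using lim by (simp add: filterlim_at_top_dense)
    then have "\<forall>\<^sub>F t in at_top. y < g t \<and> t > 0"
      using eventually_gt_at_top by (rule eventually_conj)
    then show ?thesis using eventually_happens by fastforce
  qed
  moreover have "g ` {0<..} = {y. g 0 < y \<and> (\<exists>t>0. y < g t)}"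
    using deriv pos by (rule DERIV_pos_strict_mono_image)
  ultimately show ?thesis by auto
qed

lemma DERIV_ge_pos_filterlim_at_top:
  fixes g g' :: "real \<Rightarrow> real"
  assumes deriv: "\<And>t. t \<ge> T \<Longrightarrow> (g has_real_derivative g' t) (at t)"
    and ge: "\<And>t. t \<ge> T \<Longrightarrow> g' t \<ge> c" and "c > 0"
  shows "filterlim g at_top at_top"
proof -
  have lower: "g T + c * (t - T) \<le> g t" if "t \<ge> T" for t
  proof -
    have "g T - c * T \<le> g t - c * t"
    proof (rule DERIV_nonneg_imp_nondecreasing[OF that])
      fix x assume "T \<le> x" "x \<le> t"
      then show "\<exists>y. ((\<lambda>t. g t - c * t) has_real_derivative y) (at x) \<and> 0 \<le> y"
        using ge[of x] by (intro exI[of _ "g' x - c"]) (auto intro!: derivative_eq_intros deriv)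
    qed
    then show ?thesis by (simp add: algebra_simps)
  qed
  have "filterlim (\<lambda>t. (g T - c * T) + c * t) at_top at_top"
    using \<open>c > 0\<close> by (intro filterlim_tendsto_add_at_top[OF tendsto_const]
      filterlim_tendsto_pos_mult_at_top[OF tendsto_const] filterlim_ident)
  then show ?thesis
  proof (rule filterlim_at_top_mono)
    show "\<forall>\<^sub>F t in at_top. g T - c * T + c * t \<le> g t"
      using eventually_ge_at_top[of T] by eventually_elim (use lower in \<open>simp add: algebra_simps\<close>)
  qed
qed

section \<open>Superadditivity along rows and columns\<close>

text \<open>
  With \<open>s = \<Sum>j. x j\<close>, the summand \<open>\<phi> (x j) = x j * (\<phi> (x j) / x j)\<close> is at most \<open>x j * (\<phi> s / s)\<close>, and these
  bounds add up to \<open>\<phi> s\<close>. With two or more summands, \<open>x j < s\<close> and the bound is strict.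
\<close>

lemma sum_superadditive:
  fixes \<phi> :: "real \<Rightarrow> real" and x :: "'a \<Rightarrow> real"
  assumes I: "finite I" "I \<noteq> {}" and x: "\<And>j. j \<in> I \<Longrightarrow> x j > 0"
    and ratio: "\<And>u v. 0 < u \<Longrightarrow> u < v \<Longrightarrow> \<phi> u / u < \<phi> v / v"
  shows "(\<Sum>j\<in>I. \<phi> (x j)) \<le> \<phi> (sum x I)"
    and "card I \<ge> 2 \<Longrightarrow> (\<Sum>j\<in>I. \<phi> (x j)) < \<phi> (sum x I)"
proof -
  define s where "s = sum x I"
  have s: "s > 0" unfolding s_def using I x by (intro sum_pos) auto
  have split: "\<phi> s = (\<Sum>j\<in>I. x j * (\<phi> s / s))"
    using s unfolding sum_distrib_right[symmetric] by (simp add: s_def)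
  have ratio_le: "\<phi> u / u \<le> \<phi> s / s" if "0 < u" "u \<le> s" for u
    using ratio[of u s] that by (cases "u = s") auto
  have le: "\<phi> (x j) \<le> x j * (\<phi> s / s)" if "j \<in> I" for j
  proof -
    have "x j \<le> s" unfolding s_def using that I x by (intro member_le_sum) (auto intro: less_imp_le)
    then have "x j * (\<phi> (x j) / x j) \<le> x j * (\<phi> s / s)"
      using x[OF that] by (intro mult_left_mono ratio_le) auto
    then show ?thesis using x[OF that] by simp
  qed
  then show "(\<Sum>j\<in>I. \<phi> (x j)) \<le> \<phi> (sum x I)"
    unfolding s_def[symmetric] by (subst split) (rule sum_mono)
  assume card: "card I \<ge> 2"
  obtain j where j: "j \<in> I" using I by auto
  have "I - {j} \<noteq> {}"
  proof
    assume "I - {j} = {}"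
    then have "I = {j}" using j by auto
    then show False using card by simp
  qed
  then have "sum x (I - {j}) > 0" using I x by (intro sum_pos) auto
  then have "x j < s" using I j by (simp add: s_def sum.remove[of I j])
  then have "x j * (\<phi> (x j) / x j) < x j * (\<phi> s / s)"
    using x[OF j] by (intro mult_strict_left_mono ratio) auto
  then have "\<phi> (x j) < x j * (\<phi> s / s)" using x[OF j] by simp
  then show "(\<Sum>j\<in>I. \<phi> (x j)) < \<phi> (sum x I)"
    unfolding s_def[symmetric] using I j le by (subst split) (rule sum_strict_mono_strong)
qed

locale positive_matrix =
  fixes m n :: nat and lam :: "nat \<Rightarrow> nat \<Rightarrow> real"
  assumes m: "m \<ge> 1" and n: "n \<ge> 1"
    and lam_pos: "\<And>i j. i \<in> {1..m} \<Longrightarrow> j \<in> {1..n} \<Longrightarrow> lam i j > 0"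
begin

text \<open>
  A linear functional of \<open>\<phi>\<close> that weighs the row and column sums against \<open>\<rho>\<close> times the entries.
  Only the values of \<open>\<phi>\<close> on positive arguments enter.
\<close>

definition marginal_excess :: "real \<Rightarrow> (real \<Rightarrow> real) \<Rightarrow> real" where
  "marginal_excess \<rho> \<phi> =
     (\<Sum>i=1..m. \<phi> (\<Sum>j=1..n. lam i j)) + (\<Sum>j=1..n. \<phi> (\<Sum>i=1..m. lam i j))
     - \<rho> * (\<Sum>i=1..m. \<Sum>j=1..n. \<phi> (lam i j))"

lemma row_pos: "i \<in> {1..m} \<Longrightarrow> (\<Sum>j=1..n. lam i j) > 0"
  using n lam_pos by (intro sum_pos) auto

lemma column_pos: "j \<in> {1..n} \<Longrightarrow> (\<Sum>i=1..m. lam i j) > 0"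
  using m lam_pos by (intro sum_pos) auto

lemma total_pos: "(\<Sum>i=1..m. \<Sum>j=1..n. lam i j) > 0"
  using m by (intro sum_pos[OF _ _ row_pos]) auto

lemma marginal_excess_cmult: "marginal_excess \<rho> (\<lambda>a. c * \<phi> a) = c * marginal_excess \<rho> \<phi>"
  unfolding marginal_excess_def sum_distrib_left[symmetric] by (simp add: algebra_simps)

lemma marginal_excess_diff:
  "marginal_excess \<rho> (\<lambda>a. \<phi> a - \<psi> a) = marginal_excess \<rho> \<phi> - marginal_excess \<rho> \<psi>"
  by (simp add: marginal_excess_def sum_subtractf algebra_simps)

lemma marginal_excess_ident:
  "marginal_excess \<rho> (\<lambda>a. a) = (2 - \<rho>) * (\<Sum>i=1..m. \<Sum>j=1..n. lam i j)"
  unfolding marginal_excess_def by (subst (2) sum.swap) (simp add: algebra_simps)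

lemma marginal_excess_has_real_derivative:
  assumes "\<And>a. a > 0 \<Longrightarrow> (\<phi> a has_real_derivative \<phi>' a) (at t)"
  shows "((\<lambda>t. marginal_excess \<rho> (\<lambda>a. \<phi> a t)) has_real_derivative marginal_excess \<rho> \<phi>') (at t)"
  unfolding marginal_excess_def
  by (intro DERIV_diff DERIV_add DERIV_cmult DERIV_sum assms row_pos column_pos lam_pos)

lemma tendsto_marginal_excess:
  assumes "\<And>a. a > 0 \<Longrightarrow> (\<phi> a \<longlongrightarrow> l a) F"
  shows "((\<lambda>t. marginal_excess \<rho> (\<lambda>a. \<phi> a t)) \<longlongrightarrow> marginal_excess \<rho> l) F"
  unfolding marginal_excess_def
  by (intro tendsto_intros assms row_pos column_pos lam_pos)

text \<open>
  Writing \<open>S = \<Sum>i. \<Sum>j. \<phi> (lam i j)\<close>, the excess is the row surplus over \<open>S\<close>, plus the column surplus over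
  \<open>S\<close>, plus \<open>(2 - \<rho>) * S\<close>. The row surplus is positive when \<open>n \<ge> 2\<close>, the column surplus when \<open>m \<ge> 2\<close>,
  and the third part when \<open>\<rho> < 2\<close>; for \<open>m = n = 1\<close> and \<open>\<rho> = 2\<close> all three vanish.
\<close>

lemma marginal_excess_nonneg:
  assumes \<rho>: "\<rho> \<le> 2" and pos: "\<And>u. u > 0 \<Longrightarrow> \<phi> u > 0"
    and ratio: "\<And>u v. 0 < u \<Longrightarrow> u < v \<Longrightarrow> \<phi> u / u < \<phi> v / v"
  shows "marginal_excess \<rho> \<phi> \<ge> 0"
    and "\<not> (m = 1 \<and> n = 1 \<and> \<rho> = 2) \<Longrightarrow> marginal_excess \<rho> \<phi> > 0"
proof -
  define E where "E = (\<Sum>i=1..m. \<Sum>j=1..n. \<phi> (lam i j))"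
  have E_swap: "E = (\<Sum>j=1..n. \<Sum>i=1..m. \<phi> (lam i j))"
    unfolding E_def by (rule sum.swap)
  have E: "E > 0" unfolding E_def using m n pos lam_pos by (intro sum_pos) auto
  have rows: "E \<le> (\<Sum>i=1..m. \<phi> (\<Sum>j=1..n. lam i j))"
    unfolding E_def using n ratio lam_pos by (intro sum_mono sum_superadditive(1)) auto
  have columns: "E \<le> (\<Sum>j=1..n. \<phi> (\<Sum>i=1..m. lam i j))"
    unfolding E_swap using m ratio lam_pos by (intro sum_mono sum_superadditive(1)) auto
  have rows_strict: "E < (\<Sum>i=1..m. \<phi> (\<Sum>j=1..n. lam i j))" if "n \<ge> 2"
    unfolding E_def using m n ratio lam_pos that by (intro sum_strict_mono sum_superadditive(2)) auto
  have columns_strict: "E < (\<Sum>j=1..n. \<phi> (\<Sum>i=1..m. lam i j))" if "m \<ge> 2"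
    unfolding E_swap using m n ratio lam_pos that by (intro sum_strict_mono sum_superadditive(2)) auto
  have eq: "marginal_excess \<rho> \<phi> = ((\<Sum>i=1..m. \<phi> (\<Sum>j=1..n. lam i j)) - E)
      + ((\<Sum>j=1..n. \<phi> (\<Sum>i=1..m. lam i j)) - E) + (2 - \<rho>) * E"
    by (simp add: marginal_excess_def E_def algebra_simps)
  have "(2 - \<rho>) * E \<ge> 0" using \<rho> E by simp
  then show "marginal_excess \<rho> \<phi> \<ge> 0"
    unfolding eq using rows columns by linarith
  assume "\<not> (m = 1 \<and> n = 1 \<and> \<rho> = 2)"
  then consider "n \<ge> 2" | "m \<ge> 2" | "\<rho> < 2" using m n \<rho> by fastforce
  then show "marginal_excess \<rho> \<phi> > 0"
  proof cases
    case 3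
    then have "(2 - \<rho>) * E > 0" using E by simp
    then show ?thesis unfolding eq using rows columns by linarith
  qed (use rows columns rows_strict columns_strict \<open>(2 - \<rho>) * E \<ge> 0\<close> eq in linarith)+
qed

section \<open>The logarithm of the gamma ratio and its derivatives\<close>

definition log_ratio :: "real \<Rightarrow> real \<Rightarrow> real" where
  "log_ratio \<rho> t = marginal_excess \<rho> (\<lambda>a. ln_Gamma (1 + a * t))"

text \<open>
  The index is that of the polygamma function: \<open>log_ratio_deriv \<rho> k\<close> is the derivative of order
  \<open>k + 1\<close> of \<open>log_ratio \<rho>\<close> on \<open>[0, \<infinity>)\<close>.
\<close>

definition log_ratio_deriv :: "real \<Rightarrow> nat \<Rightarrow> real \<Rightarrow> real" where
  "log_ratio_deriv \<rho> k t = marginal_excess \<rho> (\<lambda>a. a ^ Suc k * Polygamma k (1 + a * t))"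

lemma log_ratio_has_derivative:
  "t \<ge> 0 \<Longrightarrow> (log_ratio \<rho> has_real_derivative log_ratio_deriv \<rho> 0 t) (at t)"
  unfolding log_ratio_def log_ratio_deriv_def
  by (rule marginal_excess_has_real_derivative)
    (auto intro!: derivative_eq_intros add_pos_nonneg)

lemma log_ratio_deriv_has_derivative:
  "t \<ge> 0 \<Longrightarrow> (log_ratio_deriv \<rho> k has_real_derivative log_ratio_deriv \<rho> (Suc k) t) (at t)"
  unfolding log_ratio_deriv_def
  by (rule marginal_excess_has_real_derivative)
    (auto intro!: derivative_eq_intros pos_not_nonpos_Int add_pos_nonneg)

text \<open>
  Here \<open>\<phi>(a) = (-1)\<^sup>k\<^sup>+\<^sup>1 a\<^sup>k\<^sup>+\<^sup>1 \<psi>\<^sup>(\<^sup>k\<^sup>)(1 + a t)\<close>, for which \<open>\<phi>(a) / a\<close> is \<open>t\<^sup>-\<^sup>k\<close> times the increasing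
  function \<open>x \<mapsto> (-1)\<^sup>k\<^sup>+\<^sup>1 x\<^sup>k \<psi>\<^sup>(\<^sup>k\<^sup>)(1 + x)\<close> at \<open>x = a t\<close>.
\<close>

lemma log_ratio_deriv_sign:
  assumes t: "t > 0" and k: "k \<ge> 1" and \<rho>: "\<rho> \<le> 2"
  shows "(-1) ^ Suc k * log_ratio_deriv \<rho> k t \<ge> 0"
    and "\<not> (m = 1 \<and> n = 1 \<and> \<rho> = 2) \<Longrightarrow> (-1) ^ Suc k * log_ratio_deriv \<rho> k t > 0"
proof -
  define \<phi> where "\<phi> = (\<lambda>a. (-1) ^ Suc k * (a ^ Suc k * Polygamma k (1 + a * t)))"
  have eq: "(-1) ^ Suc k * log_ratio_deriv \<rho> k t = marginal_excess \<rho> \<phi>"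
    unfolding log_ratio_deriv_def \<phi>_def by (rule marginal_excess_cmult [symmetric])
  have pos: "\<phi> u > 0" if "u > 0" for u
  proof -
    have "\<phi> u = u ^ Suc k * ((-1) ^ Suc k * Polygamma k (1 + u * t))"
      by (simp add: \<phi>_def algebra_simps)
    also have "\<dots> > 0" using that t k by (intro mult_pos_pos signed_polygamma_pos) (auto simp: add_pos_pos)
    finally show ?thesis .
  qed
  have ratio: "\<phi> u / u < \<phi> v / v" if "0 < u" "u < v" for u v
  proof -
    have ratio_eq: "\<phi> w / w = ((w * t) ^ k * ((-1) ^ Suc k * Polygamma k (1 + w * t))) / t ^ k" if "w > 0" for w
      using that t by (simp add: \<phi>_def power_mult_distrib field_simps)
    show ?thesis
      unfolding ratio_eq[OF that(1)] ratio_eq[OF less_trans[OF that]]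
      using that t k by (intro divide_strict_right_mono power_times_signed_polygamma_strict_mono) auto
  qed
  show "(-1) ^ Suc k * log_ratio_deriv \<rho> k t \<ge> 0"
    unfolding eq using \<rho> pos ratio by (rule marginal_excess_nonneg)
  show "(-1) ^ Suc k * log_ratio_deriv \<rho> k t > 0" if "\<not> (m = 1 \<and> n = 1 \<and> \<rho> = 2)"
    unfolding eq using \<rho> pos ratio that by (rule marginal_excess_nonneg)
qed

lemma log_ratio_0: "log_ratio \<rho> 0 = 0"
  by (simp add: log_ratio_def marginal_excess_def ln_Gamma_real_pos)

lemma log_ratio_deriv_0_0:
  "log_ratio_deriv \<rho> 0 0 = - euler_mascheroni * (2 - \<rho>) * (\<Sum>i=1..m. \<Sum>j=1..n. lam i j)"
  using marginal_excess_cmult[of \<rho> "- euler_mascheroni" "\<lambda>a. a"]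
  by (simp add: log_ratio_deriv_def marginal_excess_ident mult.commute mult.assoc)

lemma log_ratio_deriv_1_0:
  "log_ratio_deriv \<rho> 1 0 = pi\<^sup>2 / 6 * marginal_excess \<rho> (\<lambda>a. a\<^sup>2)"
proof -
  have "(\<lambda>a. a ^ Suc 1 * Polygamma 1 (1 + a * 0)) = (\<lambda>a :: real. pi\<^sup>2 / 6 * a\<^sup>2)"
    unfolding mult_zero_right add_0_right Polygamma_1_1
    by (simp only: One_nat_def numeral_2_eq_2 mult.commute)
  then show ?thesis by (simp only: log_ratio_deriv_def marginal_excess_cmult)
qed

lemma log_ratio_deriv_1_tendsto: "(log_ratio_deriv \<rho> 1 \<longlongrightarrow> 0) at_top"
proof -
  have "((\<lambda>t. a ^ Suc 1 * Polygamma 1 (1 + a * t)) \<longlongrightarrow> 0) at_top" if a: "a > 0" for a :: real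
  proof (rule tendsto_sandwich[OF _ _ tendsto_const])
    show "\<forall>\<^sub>F t in at_top. 0 \<le> a ^ Suc 1 * Polygamma 1 (1 + a * t)"
      using eventually_gt_at_top[of 0]
    proof eventually_elim
      case (elim t)
      then have "Polygamma 1 (1 + a * t) > 0"
        using signed_polygamma_pos[of 1 "1 + a * t"] a by (simp add: add_pos_pos)
      then show ?case using a by simp
    qed
    show "\<forall>\<^sub>F t in at_top. a ^ Suc 1 * Polygamma 1 (1 + a * t) \<le> a * inverse t"
      using eventually_gt_at_top[of 0]
    proof eventually_elim
      case (elim t)
      have "a ^ Suc 1 * Polygamma 1 (1 + a * t) \<le> a ^ Suc 1 * (1 / (a * t))"
        using a elim by (intro mult_left_mono Polygamma_1_le_inverse) auto
      also have "\<dots> = a * inverse t" using a elim by (simp add: field_simps)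
      finally show ?case .
    qed
    show "((\<lambda>t. a * inverse t) \<longlongrightarrow> 0) at_top"
      using tendsto_mult_right_zero[OF tendsto_inverse_0_at_top[OF filterlim_ident]] .
  qed
  then have "(log_ratio_deriv \<rho> 1 \<longlongrightarrow> marginal_excess \<rho> (\<lambda>_. 0)) at_top"
    unfolding log_ratio_deriv_def by (rule tendsto_marginal_excess)
  then show ?thesis by (simp add: marginal_excess_def)
qed

text \<open>
  Each summand satisfies \<open>a \<psi>(1 + a t) = a ln a + a ln t + O(1 / t)\<close>; the terms \<open>a ln t\<close> add up to
  \<open>ln t\<close> times the excess of the identity function.
\<close>

lemma log_ratio_deriv_0_asymptotics:
  "((\<lambda>t. log_ratio_deriv \<rho> 0 t - (2 - \<rho>) * (\<Sum>i=1..m. \<Sum>j=1..n. lam i j) * ln t)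
     \<longlongrightarrow> marginal_excess \<rho> (\<lambda>a. a * ln a)) at_top"
proof -
  have "((\<lambda>t. a ^ Suc 0 * Digamma (1 + a * t) - ln t * a) \<longlongrightarrow> a * ln a) at_top" if a: "a > 0" for a :: real
  proof (rule tendsto_sandwich[OF _ _ tendsto_const])
    show "\<forall>\<^sub>F t in at_top. a * ln a \<le> a ^ Suc 0 * Digamma (1 + a * t) - ln t * a"
      using eventually_gt_at_top[of 0]
    proof eventually_elim
      case (elim t)
      then have "a * ln (a * t) \<le> a * Digamma (1 + a * t)"
        using a by (intro mult_left_mono Digamma_ln_bounds) auto
      then show ?case using a elim by (simp add: ln_mult_pos algebra_simps)
    qed
    show "\<forall>\<^sub>F t in at_top. a ^ Suc 0 * Digamma (1 + a * t) - ln t * a \<le> a * ln a + inverse t"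
      using eventually_gt_at_top[of 0]
    proof eventually_elim
      case (elim t)
      then have "a * Digamma (1 + a * t) \<le> a * (ln (a * t) + 1 / (a * t))"
        using a by (intro mult_left_mono Digamma_ln_bounds) auto
      moreover have "a * (1 / (a * t)) = inverse t"
        using a elim by (simp add: field_simps)
      ultimately show ?case using a elim by (simp add: ln_mult_pos ring_distribs mult.commute)
    qed
    show "((\<lambda>t. a * ln a + inverse t) \<longlongrightarrow> a * ln a) at_top"
      using tendsto_add[OF tendsto_const tendsto_inverse_0_at_top[OF filterlim_ident], of "a * ln a"]
      by simp
  qed
  then have "((\<lambda>t. marginal_excess \<rho> (\<lambda>a. a ^ Suc 0 * Digamma (1 + a * t) - ln t * a))
      \<longlongrightarrow> marginal_excess \<rho> (\<lambda>a. a * ln a)) at_top"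
    by (rule tendsto_marginal_excess)
  then show ?thesis
    unfolding log_ratio_deriv_def marginal_excess_diff marginal_excess_cmult marginal_excess_ident
    by (simp add: mult.commute)
qed

lemma log_ratio_deriv_0_at_top:
  assumes "\<rho> < 2"
  shows "filterlim (log_ratio_deriv \<rho> 0) at_top at_top"
proof -
  define c where "c = (2 - \<rho>) * (\<Sum>i=1..m. \<Sum>j=1..n. lam i j)"
  have "c > 0" using total_pos assms by (simp add: c_def)
  then have "filterlim (\<lambda>t. c * ln t) at_top at_top"
    by (intro filterlim_tendsto_pos_mult_at_top[OF tendsto_const] ln_at_top)
  from filterlim_tendsto_add_at_top[OF log_ratio_deriv_0_asymptotics[of \<rho>] this]
  show ?thesis by (simp add: c_def)
qed

lemma gamma_ratio_eq_exp:
  assumes "\<And>i. i \<in> {1..m} \<Longrightarrow> \<alpha> i = (\<Sum>j=1..n. lam i j)"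
    and "\<And>j. j \<in> {1..n} \<Longrightarrow> \<beta> j = (\<Sum>i=1..m. lam i j)" and t: "t \<ge> 0"
  shows "gamma_ratio m n lam \<alpha> \<beta> \<rho> t = exp (log_ratio \<rho> t)"
proof -
  have Gamma_exp: "Gamma (1 + a * t) = exp (ln_Gamma (1 + a * t))" if "a > 0" for a
    using that t by (intro Gamma_real_pos_exp) (simp add: add_pos_nonneg)
  have "(\<Prod>i=1..m. Gamma (1 + \<alpha> i * t)) = exp (\<Sum>i=1..m. ln_Gamma (1 + (\<Sum>j=1..n. lam i j) * t))"
    unfolding exp_sum[OF finite_atLeastAtMost] using assms row_pos by (intro prod.cong refl) (simp add: Gamma_exp)
  moreover have "(\<Prod>j=1..n. Gamma (1 + \<beta> j * t)) = exp (\<Sum>j=1..n. ln_Gamma (1 + (\<Sum>i=1..m. lam i j) * t))"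
    unfolding exp_sum[OF finite_atLeastAtMost] using assms column_pos by (intro prod.cong refl) (simp add: Gamma_exp)
  moreover have "(\<Prod>i=1..m. \<Prod>j=1..n. Gamma (1 + lam i j * t)) = exp (\<Sum>i=1..m. \<Sum>j=1..n. ln_Gamma (1 + lam i j * t))"
    unfolding exp_sum[OF finite_atLeastAtMost] using lam_pos by (intro prod.cong refl) (simp add: Gamma_exp)
  ultimately show ?thesis
    by (simp add: gamma_ratio_def log_ratio_def marginal_excess_def powr_def exp_add exp_diff)
qed

end

section \<open>Monotonicity, convexity and range of the gamma ratio\<close>

theorem theorem4p1:
  fixes m n :: nat
    and lam :: "nat \<Rightarrow> nat \<Rightarrow> real"
    and \<alpha> \<beta> :: "nat \<Rightarrow> real"
    and \<rho> :: real
  assumes "m \<ge> 1" and "n \<ge> 1"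
    and "\<And>i j. i \<in> {1..m} \<Longrightarrow> j \<in> {1..n} \<Longrightarrow> lam i j > 0"
    and "\<And>i. i \<in> {1..m} \<Longrightarrow> \<alpha> i = (\<Sum>j=1..n. lam i j)"
    and "\<And>j. j \<in> {1..n} \<Longrightarrow> \<beta> j = (\<Sum>i=1..m. lam i j)"
  shows
    "let f = gamma_ratio m n lam \<alpha> \<beta> \<rho>;
         L = (\<lambda>t. ln (f t));
         degenerate = (m = 1 \<and> n = 1 \<and> \<rho> = 2)
     in
       (\<forall>t>0. f differentiable (at t) \<and> L differentiable (at t) \<and> deriv L differentiable (at t)) \<and>
       (\<rho> \<le> 2 \<longrightarrow>
          completely_monotonic_on {0<..} (deriv (deriv L)) \<and>
          (\<not> degenerate \<longrightarrow>
             deriv (deriv L) ` {0<..} =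
               {0<..<pi\<^sup>2 / 6 * ((\<Sum>i=1..m. (\<alpha> i)\<^sup>2) + (\<Sum>j=1..n. (\<beta> j)\<^sup>2)
                                  - \<rho> * (\<Sum>i=1..m. \<Sum>j=1..n. (lam i j)\<^sup>2))})) \<and>
       (\<rho> = 2 \<longrightarrow>
          (\<forall>t>0. deriv L t = deriv f t / f t) \<and>
          bernstein_on {0<..} (deriv L) \<and>
          (\<not> degenerate \<longrightarrow>
             deriv L ` {0<..} =
               {0<..<ln (((\<Prod>i=1..m. \<alpha> i powr \<alpha> i) * (\<Prod>j=1..n. \<beta> j powr \<beta> j)) /
                         (\<Prod>i=1..m. \<Prod>j=1..n. lam i j powr lam i j)\<^sup>2)})) \<and>
       (\<rho> < 2 \<longrightarrow>
          strict_mono_on {0<..} (deriv L) \<and>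
          concave_on {0<..} (deriv L) \<and>
          deriv L ` {0<..} =
            {- euler_mascheroni * (2 - \<rho>) * (\<Sum>i=1..m. \<Sum>j=1..n. lam i j)<..}) \<and>
       (\<rho> = 2 \<longrightarrow>
          mono_on {0<..} f \<and>
          log_convex_on {0<..} f \<and>
          (\<not> degenerate \<longrightarrow>
             strict_mono_on {0<..} f \<and> f ` {0<..} = {1<..})) \<and>
       (\<rho> < 2 \<longrightarrow>
          (\<exists>!t\<^sub>0. t\<^sub>0 > 0 \<and> (\<forall>t>0. f t\<^sub>0 \<le> f t)) \<and>
          log_convex_on {0<..} f \<and>
          (f \<longlongrightarrow> 1) (at_right 0) \<and>
          filterlim f at_top at_top)"
proof -
  interpret positive_matrix m n lam
    using assms(1-3) by unfold_locales auto
  define f where "f = gamma_ratio m n lam \<alpha> \<beta> \<rho>"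
  define L where "L = (\<lambda>t. ln (f t))"
  define P where "P = log_ratio_deriv \<rho>"
  define nondegenerate where "nondegenerate \<longleftrightarrow> \<not> (m = 1 \<and> n = 1 \<and> \<rho> = 2)"
  have f_exp: "f t = exp (log_ratio \<rho> t)" if "t \<ge> 0" for t
    unfolding f_def using assms(4,5) that by (rule gamma_ratio_eq_exp)
  have L_eq: "L t = log_ratio \<rho> t" if "t \<ge> 0" for t
    using that by (simp add: L_def f_exp)
  have P_deriv: "(P k has_real_derivative P (Suc k) t) (at t)" if "t \<ge> 0" for k t
    unfolding P_def using that by (rule log_ratio_deriv_has_derivative)
  have L_deriv: "(L has_real_derivative P 0 t) (at t)" if "t > 0" for t
    by (rule has_field_derivative_transform_within_open[of "log_ratio \<rho>" _ _ "{0<..}"])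
      (use that log_ratio_has_derivative L_eq in \<open>auto simp: P_def\<close>)
  have f_deriv: "(f has_real_derivative exp (log_ratio \<rho> t) * P 0 t) (at t)" if "t > 0" for t
    by (rule has_field_derivative_transform_within_open[of "\<lambda>t. exp (log_ratio \<rho> t)" _ _ "{0<..}"])
      (use that f_exp in \<open>auto simp: P_def intro!: derivative_eq_intros log_ratio_has_derivative\<close>)
  have dL: "deriv L t = P 0 t" if "t > 0" for t
    using L_deriv[OF that] by (rule DERIV_imp_deriv)
  have dL_deriv: "(deriv L has_real_derivative P 1 t) (at t)" if "t > 0" for t
    by (rule has_field_derivative_transform_within_open[of "P 0" _ _ "{0<..}"])
      (use that P_deriv[of t 0] dL in auto)
  have ddL: "deriv (deriv L) t = P 1 t" if "t > 0" for t
    using dL_deriv[OF that] by (rule DERIV_imp_deriv)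
  have sign: "(-1) ^ k * P (Suc k) t \<ge> 0" if "t > 0" "\<rho> \<le> 2" for k t
    using log_ratio_deriv_sign(1)[of t "Suc k" \<rho>] that by (simp add: P_def)
  have sign_strict: "(-1) ^ k * P (Suc k) t > 0" if "t > 0" "\<rho> \<le> 2" nondegenerate for k t
    using log_ratio_deriv_sign(2)[of t "Suc k" \<rho>] that by (simp add: P_def nondegenerate_def)
  have excess_eq: "marginal_excess \<rho> \<phi> = (\<Sum>i=1..m. \<phi> (\<alpha> i)) + (\<Sum>j=1..n. \<phi> (\<beta> j))
      - \<rho> * (\<Sum>i=1..m. \<Sum>j=1..n. \<phi> (lam i j))" for \<phi>
    using assms(4,5) by (simp add: marginal_excess_def)

  have smooth: "f differentiable (at t) \<and> L differentiable (at t) \<and> deriv L differentiable (at t)" if "t > 0" for t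
    using f_deriv[OF that] L_deriv[OF that] dL_deriv[OF that] by (auto simp: real_differentiable_def)

  have cm: "completely_monotonic_on {0<..} g" if "\<rho> \<le> 2" "\<And>t. t > 0 \<Longrightarrow> g t = P 1 t" for g
    unfolding completely_monotonic_on_def
    using that sign P_deriv
    by (intro conjI exI[of _ "\<lambda>k. P (Suc k)"]) (auto simp: is_interval_oi intro: has_field_derivative_at_within)

  have second_image: "deriv (deriv L) ` {0<..} =
      {0<..<pi\<^sup>2 / 6 * ((\<Sum>i=1..m. (\<alpha> i)\<^sup>2) + (\<Sum>j=1..n. (\<beta> j)\<^sup>2)
                         - \<rho> * (\<Sum>i=1..m. \<Sum>j=1..n. (lam i j)\<^sup>2))}"
    if "\<rho> \<le> 2" nondegenerate
  proof -
    \<comment> \<open>\<open>P 1\<close> decreases, so the range result for increasing functions is applied to \<open>- P 1\<close>.\<close>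
    have "(\<lambda>t. - P 1 t) ` {0<..} = {- P 1 0<..<- 0}"
    proof (rule DERIV_pos_image_tendsto)
      show "((\<lambda>t. - P 1 t) has_real_derivative - P 2 t) (at t)" if "t \<ge> 0" for t
        using DERIV_minus[OF P_deriv[OF that, of 1]] by (simp add: numeral_2_eq_2)
      show "- P 2 t > 0" if "t > 0" for t
        using sign_strict[OF that \<open>\<rho> \<le> 2\<close> \<open>nondegenerate\<close>, of 1] by (simp add: numeral_2_eq_2)
      show "((\<lambda>t. - P 1 t) \<longlongrightarrow> - 0) at_top"
        unfolding P_def by (intro tendsto_minus log_ratio_deriv_1_tendsto)
    qed
    then have "uminus ` (\<lambda>t. - P 1 t) ` {0<..} = {0<..<P 1 0}" by simp
    moreover have "deriv (deriv L) ` {0<..} = uminus ` (\<lambda>t. - P 1 t) ` {0<..}"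
      unfolding image_image by (intro image_cong) (auto simp: ddL)
    ultimately show ?thesis
      by (simp only: P_def log_ratio_deriv_1_0 excess_eq)
  qed

  have dL_image: "deriv L ` {0<..} = P 0 ` {0<..}"
    by (intro image_cong) (auto simp: dL)

  have log_convex: "log_convex_on {0<..} f" if "\<rho> \<le> 2"
    unfolding log_convex_on_def L_def[symmetric]
  proof
    show "\<forall>x\<in>{0<..}. 0 < f x" by (simp add: f_exp)
    show "convex_on {0<..} L"
      using L_deriv P_deriv[of _ 0] sign[of _ 0] that
      by (intro f''_ge0_imp_convex[of _ _ "P 0" "P 1"]) auto
  qed

  have P0_mono: "strict_mono_on {0..} (P 0)" if "\<rho> \<le> 2" nondegenerate
  proof (rule DERIV_pos_strict_mono_image)
    show "(P 0 has_real_derivative P 1 t) (at t)" if "t \<ge> 0" for t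
      using P_deriv[OF that, of 0] by simp
    show "P 1 t > 0" if "t > 0" for t
      using sign_strict[OF that \<open>\<rho> \<le> 2\<close> \<open>nondegenerate\<close>, of 0] by simp
  qed

  have P0_0: "P 0 0 = 0" if "\<rho> = 2"
    using that by (simp add: P_def log_ratio_deriv_0_0)
  have P0_nonneg: "P 0 t \<ge> 0" if "\<rho> = 2" "t > 0" for t
  proof -
    have "P 0 0 \<le> P 0 t"
    proof (rule DERIV_nonneg_imp_increasing_open[where f = "P 0"])
      show "\<exists>y. (P 0 has_real_derivative y) (at x) \<and> 0 \<le> y" if "0 < x" for x
        using P_deriv[of x 0] sign[of x 0] that \<open>\<rho> = 2\<close> by auto
      show "continuous_on {0..t} (P 0)"
        by (intro continuous_at_imp_continuous_on ballI DERIV_isCont[OF P_deriv]) auto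
    qed (use that in simp)
    then show ?thesis using P0_0 that by simp
  qed

  have bernstein: "bernstein_on {0<..} (deriv L)" if "\<rho> = 2"
    unfolding bernstein_on_def
  proof (intro conjI exI[of _ "P 1"] ballI)
    show "deriv L t \<ge> 0" if "t \<in> {0<..}" for t
      using that P0_nonneg[OF \<open>\<rho> = 2\<close>] by (simp add: dL)
    show "(deriv L has_real_derivative P 1 t) (at t within {0<..})" if "t \<in> {0<..}" for t
      using that dL_deriv by (auto intro: has_field_derivative_at_within)
    show "completely_monotonic_on {0<..} (P 1)"
      using cm that by simp
  qed

  have first_image_2: "deriv L ` {0<..} =
      {0<..<ln (((\<Prod>i=1..m. \<alpha> i powr \<alpha> i) * (\<Prod>j=1..n. \<beta> j powr \<beta> j)) /
                (\<Prod>i=1..m. \<Prod>j=1..n. lam i j powr lam i j)\<^sup>2)}"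
    if "\<rho> = 2" nondegenerate
  proof -
    have \<alpha>: "\<alpha> i > 0" if "i \<in> {1..m}" for i using row_pos that assms(4) by simp
    have \<beta>: "\<beta> j > 0" if "j \<in> {1..n}" for j using column_pos that assms(5) by simp
    have powr_exp: "a powr a = exp (a * ln a)" if "a > 0" for a :: real
      using that by (simp add: powr_def)
    have "(\<Prod>i=1..m. \<alpha> i powr \<alpha> i) = exp (\<Sum>i=1..m. \<alpha> i * ln (\<alpha> i))"
      unfolding exp_sum[OF finite_atLeastAtMost] using \<alpha> by (intro prod.cong refl powr_exp)
    moreover have "(\<Prod>j=1..n. \<beta> j powr \<beta> j) = exp (\<Sum>j=1..n. \<beta> j * ln (\<beta> j))"
      unfolding exp_sum[OF finite_atLeastAtMost] using \<beta> by (intro prod.cong refl powr_exp)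
    moreover have "(\<Prod>i=1..m. \<Prod>j=1..n. lam i j powr lam i j) = exp (\<Sum>i=1..m. \<Sum>j=1..n. lam i j * ln (lam i j))"
      unfolding exp_sum[OF finite_atLeastAtMost] by (intro prod.cong refl powr_exp lam_pos)
    ultimately have ln_eq: "ln (((\<Prod>i=1..m. \<alpha> i powr \<alpha> i) * (\<Prod>j=1..n. \<beta> j powr \<beta> j)) /
                (\<Prod>i=1..m. \<Prod>j=1..n. lam i j powr lam i j)\<^sup>2) = marginal_excess \<rho> (\<lambda>a. a * ln a)"
      unfolding excess_eq using that by (simp flip: exp_add exp_diff exp_double)
    have "P 0 ` {0<..} = {P 0 0<..<marginal_excess \<rho> (\<lambda>a. a * ln a)}"
    proof (rule DERIV_pos_image_tendsto)
      show "(P 0 has_real_derivative P 1 t) (at t)" if "t \<ge> 0" for t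
        using P_deriv[OF that, of 0] by simp
      show "P 1 t > 0" if "t > 0" for t
        using sign_strict[OF that _ \<open>nondegenerate\<close>, of 0] \<open>\<rho> = 2\<close> by simp
      show "(P 0 \<longlongrightarrow> marginal_excess \<rho> (\<lambda>a. a * ln a)) at_top"
        using log_ratio_deriv_0_asymptotics[of \<rho>] that by (simp add: P_def)
    qed
    then show ?thesis unfolding dL_image ln_eq using P0_0 that by simp
  qed

  have first_image: "deriv L ` {0<..} =
      {- euler_mascheroni * (2 - \<rho>) * (\<Sum>i=1..m. \<Sum>j=1..n. lam i j)<..}" if "\<rho> < 2"
  proof -
    have "P 0 ` {0<..} = {P 0 0<..}"
    proof (rule DERIV_pos_image_at_top)
      show "(P 0 has_real_derivative P 1 t) (at t)" if "t \<ge> 0" for t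
        using P_deriv[OF that, of 0] by simp
      show "P 1 t > 0" if "t > 0" for t
        using sign_strict[OF that, of 0] \<open>\<rho> < 2\<close> by (simp add: nondegenerate_def)
      show "filterlim (P 0) at_top at_top"
        unfolding P_def using that by (rule log_ratio_deriv_0_at_top)
    qed
    then show ?thesis unfolding dL_image by (simp add: P_def log_ratio_deriv_0_0)
  qed

  have first_mono: "strict_mono_on {0<..} (deriv L)" if "\<rho> < 2"
    using P0_mono that by (auto simp: strict_mono_on_def dL nondegenerate_def)

  have first_concave: "concave_on {0<..} (deriv L)" if "\<rho> < 2"
    using dL_deriv P_deriv[of _ 1] sign[of _ 1] that
    by (intro f''_le0_imp_concave[of _ _ "P 1" "P 2"]) (auto simp: numeral_2_eq_2)

  \<comment> \<open>As \<open>P 0\<close> increases, one positive value of it forces at least linear growth of \<open>L\<close>.\<close>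
  have f_at_top: "filterlim f at_top at_top" if "\<rho> \<le> 2" nondegenerate "T > 0" "P 0 T > 0" for T
  proof -
    have "filterlim (log_ratio \<rho>) at_top at_top"
    proof (rule DERIV_ge_pos_filterlim_at_top[OF _ _ \<open>P 0 T > 0\<close>])
      show "(log_ratio \<rho> has_real_derivative P 0 t) (at t)" if "t \<ge> T" for t
        using log_ratio_has_derivative[of t \<rho>] that \<open>T > 0\<close> by (simp add: P_def)
      show "P 0 T \<le> P 0 t" if "t \<ge> T" for t
        using strict_mono_on_leD[OF P0_mono[OF \<open>\<rho> \<le> 2\<close> \<open>nondegenerate\<close>], of T t] that \<open>T > 0\<close> by simp
    qed
    then have "filterlim (\<lambda>t. exp (log_ratio \<rho> t)) at_top at_top"
      by (rule filterlim_compose[OF exp_at_top])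
    then show ?thesis
      by (rule filterlim_cong[THEN iffD1, OF refl refl, rotated])
        (use eventually_ge_at_top[of 0] in eventually_elim, simp add: f_exp)
  qed

  have f_mono: "mono_on {0<..} f" if "\<rho> = 2"
  proof (rule mono_onI)
    fix s t :: real assume st: "s \<in> {0<..}" "t \<in> {0<..}" "s \<le> t"
    show "f s \<le> f t"
    proof (rule DERIV_nonneg_imp_nondecreasing[OF \<open>s \<le> t\<close>])
      fix x assume "s \<le> x" "x \<le> t"
      then show "\<exists>y. (f has_real_derivative y) (at x) \<and> 0 \<le> y"
        using st f_deriv[of x] P0_nonneg[OF \<open>\<rho> = 2\<close>, of x] by auto
    qed
  qed

  have f_2: "strict_mono_on {0<..} f" "f ` {0<..} = {1<..}" if "\<rho> = 2" nondegenerate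
  proof -
    have P0_pos: "P 0 t > 0" if "t > 0" for t
      using strict_mono_onD[OF P0_mono, of 0 t] that P0_0 \<open>\<rho> = 2\<close> \<open>nondegenerate\<close> by simp
    have deriv: "((\<lambda>t. exp (log_ratio \<rho> t)) has_real_derivative exp (log_ratio \<rho> t) * P 0 t) (at t)" if "t \<ge> 0" for t
      using that by (auto simp: P_def intro!: derivative_eq_intros log_ratio_has_derivative)
    have pos: "exp (log_ratio \<rho> t) * P 0 t > 0" if "t > 0" for t
      using P0_pos that by simp
    have "strict_mono_on {0..} (\<lambda>t. exp (log_ratio \<rho> t))"
      using deriv pos by (rule DERIV_pos_strict_mono_image)
    then show "strict_mono_on {0<..} f"
      by (auto simp: strict_mono_on_def f_exp)
    have "filterlim (\<lambda>t. exp (log_ratio \<rho> t)) at_top at_top"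
      using f_at_top[of 1] P0_pos[of 1] that
      by (subst filterlim_cong[OF refl refl, of _ f])
        (auto intro!: eventually_mono[OF eventually_ge_at_top[of 0]] simp: f_exp)
    with deriv pos have "(\<lambda>t. exp (log_ratio \<rho> t)) ` {0<..} = {exp (log_ratio \<rho> 0)<..}"
      by (rule DERIV_pos_image_at_top)
    moreover have "f ` {0<..} = (\<lambda>t. exp (log_ratio \<rho> t)) ` {0<..}"
      by (intro image_cong) (auto simp: f_exp)
    ultimately show "f ` {0<..} = {1<..}" by (simp add: log_ratio_0)
  qed

  have f_less_2: "(\<exists>!t\<^sub>0. t\<^sub>0 > 0 \<and> (\<forall>t>0. f t\<^sub>0 \<le> f t)) \<and> (f \<longlongrightarrow> 1) (at_right 0) \<and> filterlim f at_top at_top"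
    if "\<rho> < 2"
  proof (intro conjI)
    have nondeg: nondegenerate using that by (simp add: nondegenerate_def)
    note mono = P0_mono[OF less_imp_le[OF that] nondeg]
    have "euler_mascheroni * (2 - \<rho>) * (\<Sum>i=1..m. \<Sum>j=1..n. lam i j) > 0"
      using that total_pos euler_mascheroni_pos by simp
    \<comment> \<open>The derivative of \<open>L\<close> starts below \<open>0\<close> because \<open>\<gamma> > 0\<close>: its only zero \<open>t0\<close> is the minimum,
      and the point \<open>T\<close> where it equals \<open>1\<close> gives the growth at infinity.\<close>
    then have "0 \<in> P 0 ` {0<..}" "1 \<in> P 0 ` {0<..}"
      using first_image[OF that] unfolding dL_image by auto
    then obtain t0 T where t0: "t0 > 0" "P 0 t0 = 0" and T: "T > 0" "P 0 T = 1"
      by (metis imageE greaterThan_iff)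
    show "filterlim f at_top at_top"
      using f_at_top[of T] T nondeg that by simp
    have lt: "f t0 < f t" if t: "t > 0" "t \<noteq> t0" for t
    proof (cases "t < t0")
      case True
      show ?thesis
      proof (rule DERIV_neg_imp_decreasing_open[OF True])
        fix x assume x: "t < x" "x < t0"
        then have "P 0 x < 0" using strict_mono_onD[OF mono, of x t0] t t0 by simp
        then show "\<exists>y. (f has_real_derivative y) (at x) \<and> y < 0"
          using f_deriv[of x] x t by (auto intro!: exI mult_pos_neg)
      next
        show "continuous_on {t..t0} f"
          using t by (intro continuous_at_imp_continuous_on ballI DERIV_isCont[OF f_deriv]) auto
      qed
    next
      case False
      then have "t0 < t" using t by simp
      then show ?thesis
      proof (rule DERIV_pos_imp_increasing_open)
        fix x assume x: "t0 < x" "x < t"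
        then have "P 0 x > 0" using strict_mono_onD[OF mono, of t0 x] t0 by simp
        then show "\<exists>y. (f has_real_derivative y) (at x) \<and> y > 0"
          using f_deriv[of x] x t0 by (auto intro!: exI mult_pos_pos)
      next
        show "continuous_on {t0..t} f"
          using t0 by (intro continuous_at_imp_continuous_on ballI DERIV_isCont[OF f_deriv]) auto
      qed
    qed
    show "\<exists>!t\<^sub>0. t\<^sub>0 > 0 \<and> (\<forall>t>0. f t\<^sub>0 \<le> f t)"
    proof (rule ex1I[of _ t0])
      show "t0 > 0 \<and> (\<forall>t>0. f t0 \<le> f t)"
        using t0 lt by (metis less_imp_le order_refl)
      show "s = t0" if "s > 0 \<and> (\<forall>t>0. f s \<le> f t)" for s
        using that lt[of s] t0 by (metis not_le)
    qed
    have "isCont (\<lambda>t. exp (log_ratio \<rho> t)) 0"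
      using DERIV_isCont[OF log_ratio_has_derivative[of 0 \<rho>]] by (intro continuous_intros) auto
    then have "((\<lambda>t. exp (log_ratio \<rho> t)) \<longlongrightarrow> 1) (at_right 0)"
      unfolding isCont_def by (auto simp: log_ratio_0 intro: tendsto_mono[OF at_le])
    then show "(f \<longlongrightarrow> 1) (at_right 0)"
      by (rule Lim_transform_eventually) (auto simp: eventually_at_filter f_exp)
  qed

  have quotient: "deriv L t = deriv f t / f t" if "t > 0" for t
    using DERIV_imp_deriv[OF f_deriv[OF that]] that by (simp add: dL f_exp)

  show ?thesis
    unfolding Let_def f_def[symmetric] L_def[symmetric] nondegenerate_def[symmetric]
    using smooth cm ddL second_image quotient bernstein first_image_2 first_mono first_concave
      first_image f_mono log_convex f_2 f_less_2
    by auto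
qed

end
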